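(* Let $q=p^{m_0}$, $A=\mathbb{F}_q[\theta]$, let $\beta\ge 0$ and $j\ge 0$ be integers, and regard $t$ as an indeterminate. Define $$z(\chi_t^\beta,x,-j):=\sum_{e=0}^\infty x^{-e}\Bigl(\sum_{a\in A_+(e)}\chi_t(a)^\beta a^j\Bigr).$$ Then $z(\chi_t^\beta,x,-j)\in A[t][x^{-1}]$, i.e. it is a polynomial in $x^{-1}$ with coefficients in $A[t]$.
   Context: $A_+(e)$ denotes the set of monic polynomials in $A$ of degree $e$. For $a=a(\theta)\in A$, $\chi_t(a):=a(t)$, the polynomial obtained by substituting $t$ for $\theta$. (In terms of the Pellarin $L$-series $L(\chi_t^\beta,s)=\sum_{a\in A_+}\chi_t(a)^\beta a^{-s}$ on $\mathbb{S}_\infty=\mathbb{C}_\infty^\ast\times\mathbb{Z}_p$, with $a^{(x,y)}=x^{\deg a}(\theta^{-\deg a}a)^y$, one has $z(\chi_t^\beta,x,-j)=L(\chi_t^\beta,(x\theta^{-j},-j))$.) *)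

theory Defs
  imports "HOL-Computational_Algebra.Computational_Algebra" "HOL-Library.Cardinality"
begin

text \<open>
  For a finite field \<open>'a\<close>, the type \<open>'a poly\<close> is the ring $A$ with variable $\theta$,
  and \<open>'a poly poly\<close> is $A[t]$: the outer variable is $t$, and $a \in A$ is embedded
  as the constant polynomial \<open>[:a:]\<close>.
\<close>

definition monic_of_degree :: "nat \<Rightarrow> 'a::field poly set" where
  "monic_of_degree e = {a. lead_coeff a = 1 \<and> degree a = e}"

text \<open>The scalar $c$ of the field is \<open>[:[:c:]:]\<close> in $A[t]$, and $t$ itself is \<open>[:0, 1:]\<close>.\<close>

definition chi_t :: "'a::field poly \<Rightarrow> 'a poly poly" where
  "chi_t a = poly (map_poly (\<lambda>c. [:[:c:]:]) a) [:0, 1:]"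

text \<open>
  The sum over $e$ is read in $A[t][[x^{-1}]]$: the formal power series variable
  stands for $x^{-1}$.
\<close>

definition z_chi :: "nat \<Rightarrow> nat \<Rightarrow> 'a::{field,finite} poly poly fps" where
  "z_chi \<beta> j = Abs_fps (\<lambda>e. \<Sum>a\<in>monic_of_degree e. chi_t a ^ \<beta> * [:a:] ^ j)"

end

theory Submission imports Defs begin

text \<open>
  A monic polynomial of degree $e$ is affine in its $e$ free coefficients, so the summand is a
  product of $\beta + j$ affine forms in them. If $e > \beta + j$, each monomial of the expanded
  product misses some coefficient, and summing over that coefficient gives a factor $q = 0$.
\<close>

text \<open>This is the space of the free coefficients. Stated as \<open>degree a < n\<close> it
  would be empty for n = 0, because \<open>degree 0 = 0\<close>; in this form it is {0}.\<close>

definition polys_below :: "nat \<Rightarrow> 'a::zero poly set" where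
  "polys_below n = {a. \<forall>k\<ge>n. coeff a k = 0}"

lemma polys_below_0: "polys_below 0 = {0}"
  by (auto simp: polys_below_def poly_eq_iff)

lemma bij_betw_polys_below_Suc:
  "bij_betw (\<lambda>(a, c). a + monom c n) (polys_below n \<times> (UNIV :: 'a::ab_group_add set))
     (polys_below (Suc n))"
proof (rule bij_betw_byWitness[where f' = "\<lambda>a. (a - monom (coeff a n) n, coeff a n)"])
qed (auto simp: polys_below_def)

lemma sum_polys_below_Suc:
  fixes g :: "'a::ab_group_add poly \<Rightarrow> 'r::comm_monoid_add"
  shows "(\<Sum>a\<in>polys_below (Suc n). g a) = (\<Sum>a\<in>polys_below n. \<Sum>c\<in>UNIV. g (a + monom c n))"
  by (simp add: sum.reindex_bij_betw[OF bij_betw_polys_below_Suc, symmetric]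
      sum.cartesian_product case_prod_unfold)

lemma bij_betw_monic_of_degree:
  "bij_betw ((+) (monom 1 e)) (polys_below e) (monic_of_degree e :: 'a::field poly set)"
proof (rule bij_betw_byWitness[where f' = "\<lambda>a. a - monom 1 e"])
  show "(+) (monom 1 e) ` polys_below e \<subseteq> (monic_of_degree e :: 'a poly set)"
  proof
    fix b :: "'a poly"
    assume "b \<in> (+) (monom 1 e) ` polys_below e"
    then have b: "coeff b e = 1" "\<forall>k>e. coeff b k = 0"
      by (auto simp: polys_below_def)
    then have "degree b = e"
      by (intro antisym degree_le le_degree) auto
    with b show "b \<in> monic_of_degree e"
      by (simp add: monic_of_degree_def)
  qed
qed (auto simp: polys_below_def monic_of_degree_def coeff_eq_0 le_less)

text \<open>Translation by 1 permutes the ring, so the sum of all elements does not change when 1 is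
  added to each of them; cancel that sum.\<close>

lemma of_nat_CARD_eq_0: "of_nat CARD('a) = (0 :: 'a::{ring_1,finite})"
proof -
  have "(\<Sum>c\<in>UNIV. c + 1 :: 'a) = (\<Sum>c\<in>UNIV. c)"
    by (rule sum.reindex_bij_witness[of _ "\<lambda>c. c - 1" "\<lambda>c. c + 1"]) auto
  then show ?thesis
    by (simp add: sum.distrib)
qed

text \<open>The coefficients are summed out one at a time, from the top. Each is either missed by
  all remaining factors or uses up at least one of them, and fewer than n factors cannot serve n
  coefficients. Since the set of factors shrinks, the induction leaves \<open>I\<close>
  arbitrary.\<close>

lemma sum_prod_affine_eq_0:
  fixes f :: "'i \<Rightarrow> 'a::{ab_group_add,finite} poly \<Rightarrow> 'r::comm_ring_1"
  assumes "\<And>i a c k. f i (a + monom c k) = f i a + s c * v i k"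
    and "of_nat CARD('a) = (0 :: 'r)"
    and "finite I" and "card I < n"
  shows "(\<Sum>a\<in>polys_below n. \<Prod>i\<in>I. f i a) = 0"
  using assms(3,4)
proof (induction n arbitrary: I)
  case (Suc n)
  \<comment> \<open>T collects the factors from which \<open>f i a\<close> is taken; the others
    contribute their part in the coefficient c of degree n.\<close>
  have "(\<Sum>a\<in>polys_below (Suc n). \<Prod>i\<in>I. f i a)
      = (\<Sum>a\<in>polys_below n. \<Sum>c\<in>UNIV. \<Sum>T\<in>Pow I. prod (\<lambda>i. f i a) T * (\<Prod>i\<in>I - T. s c * v i n))"
    using Suc.prems by (simp add: sum_polys_below_Suc assms(1) prod_add)
  \<comment> \<open>With the sum over a innermost, the product over \<open>I - T\<close>, which is
    free of a, can be pulled out.\<close>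
  also have "\<dots> = (\<Sum>T\<in>Pow I. \<Sum>c\<in>UNIV. \<Sum>a\<in>polys_below n.
      prod (\<lambda>i. f i a) T * (\<Prod>i\<in>I - T. s c * v i n))"
    by (subst sum.swap[of _ "Pow I"], subst sum.swap, subst sum.swap[of _ "Pow I"]) (rule refl)
  also have "\<dots> = (\<Sum>T\<in>Pow I. \<Sum>c\<in>UNIV. (\<Sum>a\<in>polys_below n.
      prod (\<lambda>i. f i a) T) * (\<Prod>i\<in>I - T. s c * v i n))"
    by (simp add: sum_distrib_right)
  also have "\<dots> = 0"
  proof (rule sum.neutral, rule)
    fix T assume T: "T \<in> Pow I"
    show "(\<Sum>c\<in>UNIV. (\<Sum>a\<in>polys_below n. prod (\<lambda>i. f i a) T) * (\<Prod>i\<in>I - T. s c * v i n)) = 0"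
    proof (cases "T = I")
      case True
      \<comment> \<open>The product over \<open>I - T\<close> is empty, so the summand is constant
        in c and is multiplied by \<open>CARD('a)\<close>.\<close>
      then show ?thesis by (simp add: assms(2))
    next
      case False
      \<comment> \<open>At least one factor has been used up, so the induction hypothesis kills the
        inner sum.\<close>
      with T have "T \<subset> I" by blast
      with Suc.prems have "finite T" "card T < n"
        using psubset_card_mono[of I T] by (auto intro: finite_subset)
      then show ?thesis by (simp add: Suc.IH)
    qed
  qed
  finally show ?case .
qed simp

lemma chi_t_add_monom: "chi_t (a + monom c k) = chi_t a + [:[:c:]:] * [:0, 1:] ^ k"
proof -
  have "map_poly (\<lambda>c. [:[:c:]:]) (a + monom c k)
      = map_poly (\<lambda>c. [:[:c:]:]) a + monom [:[:c:]:] k"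
    by (rule poly_eqI) (simp add: coeff_map_poly)
  then show ?thesis
    by (simp add: chi_t_def poly_monom)
qed

text \<open>The scalar is written as in \<open>chi_t_add_monom\<close>, because
  \<open>sum_prod_affine_eq_0\<close> takes a single \<open>s\<close> for both kinds of
  factors.\<close>

lemma const_add_monom:
  "[:a + monom c k:] = [:a:] + [:[:c:]:] * [:monom (1 :: 'a::comm_semiring_1) k:]"
  by (simp add: smult_monom)

lemma sum_monic_of_degree_eq_0:
  assumes "\<beta> + j < e"
  shows "(\<Sum>a\<in>monic_of_degree e. chi_t a ^ \<beta> * [:a:] ^ j) = (0 :: 'a::{field,finite} poly poly)"
proof -
  \<comment> \<open>The first \<beta> indices stand for the copies of \<open>chi_t\<close>, the
    other j for those of the polynomial itself. The fixed leading term goes into the factors, so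
    that a runs over \<open>polys_below e\<close>.\<close>
  let ?f = "\<lambda>i (a :: 'a poly). if i < \<beta> then chi_t (monom 1 e + a) else [:monom 1 e + a:]"
  let ?s = "\<lambda>c :: 'a. [:[:c:]:]"
  let ?v = "\<lambda>i k. if i < \<beta> then [:0, 1:] ^ k else [:monom (1 :: 'a) k:]"
  have "(\<Sum>a\<in>polys_below e. \<Prod>i<\<beta> + j. ?f i a) = 0"
  proof (rule sum_prod_affine_eq_0)
    show "?f i (a + monom c k) = ?f i a + ?s c * ?v i k" for i a c k
      by (simp only: add.assoc[symmetric] chi_t_add_monom const_add_monom[of "_ + _"] if_distrib
          cong: if_cong split: if_split) auto
    show "of_nat CARD('a) = (0 :: 'a poly poly)"
      by (simp add: of_nat_poly of_nat_CARD_eq_0)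
  qed (use assms in auto)
  moreover have "(\<Prod>i<\<beta> + j. ?f i a) = chi_t (monom 1 e + a) ^ \<beta> * [:monom 1 e + a:] ^ j" for a
  proof -
    have "{..<\<beta> + j} \<inter> {i. i < \<beta>} = {..<\<beta>}" "{..<\<beta> + j} \<inter> - {i. i < \<beta>} = {\<beta>..<\<beta> + j}"
      by auto
    then show ?thesis
      by (simp add: prod.If_cases)
  qed
  ultimately show ?thesis
    by (simp add: sum.reindex_bij_betw[OF bij_betw_monic_of_degree, symmetric])
qed

theorem theorem5p2:
  fixes p m0 \<beta> j :: nat
  assumes "prime p" and "m0 > 0" and "CARD('a::{field,finite}) = p ^ m0"
  shows "(z_chi \<beta> j :: 'a poly poly fps) \<in> range (fps_of_poly :: 'a poly poly poly \<Rightarrow> 'a poly poly fps)"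
proof (rule range_eqI)
  let ?z = "z_chi \<beta> j :: 'a poly poly fps"
  \<comment> \<open>The list ends at index \<beta> + j, the last one not covered by
    \<open>sum_monic_of_degree_eq_0\<close>; beyond it \<open>Poly\<close> has coefficient 0 by
    default.\<close>
  show "?z = fps_of_poly (Poly (map (fps_nth ?z) [0..<Suc (\<beta> + j)]))"
    by (auto simp: fps_eq_iff nth_default_def z_chi_def sum_monic_of_degree_eq_0 simp del: upt_Suc)
qed

end
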